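(* Let $m_1,\dots,m_k$ be square-free positive integers and $p_1,\dots,p_t$ all the prime divisors of $m_1\cdots m_k$. Assume $N\varepsilon_{m_i}=-1$ for each $i$, and that $m_1\cdots m_k$ is a perfect square. Then $\varepsilon_{m_1}\cdots\varepsilon_{m_k}$ is a square in $\mathbb{Q}(\sqrt{p_1},\dots,\sqrt{p_t})$.
   Context: For a square-free integer $m>1$, $\varepsilon_m$ denotes the positive (as a real number, with $\sqrt m>0$) fundamental unit of $\mathbb{Q}(\sqrt m)$, and $N\varepsilon_m$ its norm to $\mathbb{Q}$; all these fields are regarded as subfields of $\mathbb{R}$. *)

theory Defs
  imports
    "HOL-Algebra.Generated_Fields"
    "HOL-Algebra.Algebraic_Closure_Type"
    "HOL-Computational_Algebra.Computational_Algebra"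
    "HOL-Analysis.Analysis"
begin

text \<open>
  The subfield $\mathbb{Q}(S)$ of the reals; \<^const>\<open>generate_field\<close> over the field of reals
  contains 1 and is closed under the field operations, hence contains the rationals.
\<close>

definition rat_adjoin :: "real set \<Rightarrow> real set" where
  "rat_adjoin S = generate_field (ring_of_type_algebra :: real ring) S"

definition quad_integers :: "nat \<Rightarrow> real set" where
  "quad_integers m = {x \<in> rat_adjoin {sqrt (real m)}. algebraic_int x}"

definition quad_units :: "nat \<Rightarrow> real set" where
  "quad_units m = {u \<in> quad_integers m. \<exists>v \<in> quad_integers m. u * v = 1}"

text \<open>
  The nontrivial automorphism of $\mathbb{Q}(\sqrt m)$. It is only meaningful for $m$ not a
  perfect square (see the lemma below) and arguments in $\mathbb{Q}(\sqrt m)$.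
\<close>

definition quad_conj :: "nat \<Rightarrow> real \<Rightarrow> real" where
  "quad_conj m x = (THE y. \<exists>a\<in>\<rat>. \<exists>b\<in>\<rat>. x = a + b * sqrt (real m) \<and> y = a - b * sqrt (real m))"

definition quad_norm :: "nat \<Rightarrow> real \<Rightarrow> real" where
  "quad_norm m x = x * quad_conj m x"

text \<open>
  If $e$ is a positive fundamental unit then so is $e^{-1}$; the predicate does not
  select one of the two.
\<close>

definition pos_fundamental_unit :: "nat \<Rightarrow> real \<Rightarrow> bool" where
  "pos_fundamental_unit m e \<longleftrightarrow>
     e > 0 \<and> e \<in> quad_units m \<and> (\<forall>u \<in> quad_units m. \<exists>n::int. u = e powi n \<or> u = - (e powi n))"

lemma quad_conj_norm_eq:
  assumes m: "squarefree m" "m > 1" and ab: "a \<in> \<rat>" "b \<in> \<rat>"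
  shows "quad_conj m (a + b * sqrt (real m)) = a - b * sqrt (real m)"
    and "quad_norm m (a + b * sqrt (real m)) = a\<^sup>2 - real m * b\<^sup>2"
proof -
  have irr: "sqrt (real m) \<notin> \<rat>"
  proof
    assume "sqrt (real m) \<in> \<rat>"
    moreover have "algebraic_int (sqrt (real m))"
      by (intro algebraic_int_sqrt) auto
    ultimately have "sqrt (real m) \<in> \<int>"
      by (rule rational_algebraic_int_is_int[rotated])
    then obtain z :: int where z: "sqrt (real m) = of_int z"
      by (auto elim: Ints_cases)
    hence "real m = (of_int z)\<^sup>2"
      by (metis of_nat_0_le_iff real_sqrt_pow2)
    hence "int m = z\<^sup>2"
      by (metis of_int_eq_iff of_int_of_nat_eq of_int_power)
    hence "m = (nat \<bar>z\<bar>)\<^sup>2"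
      by (metis nat_abs_int_diff nat_int nat_power_eq abs_ge_zero power2_abs)
    with m(1) have "nat \<bar>z\<bar> dvd 1"
      unfolding squarefree_def by auto
    with \<open>m = (nat \<bar>z\<bar>)\<^sup>2\<close> m(2) show False by simp
  qed
  have uniq: "a = c \<and> b = d"
    if "a + b * sqrt (real m) = c + d * sqrt (real m)" "c \<in> \<rat>" "d \<in> \<rat>" for c d
  proof -
    have eq: "(b - d) * sqrt (real m) = c - a"
      using that by (simp add: algebra_simps)
    have "b = d"
    proof (rule ccontr)
      assume "b \<noteq> d"
      with eq have "sqrt (real m) = (c - a) / (b - d)" by (simp add: field_simps)
      also have "\<dots> \<in> \<rat>" using ab that by auto
      finally show False using irr by simp
    qed
    with eq show ?thesis by simp
  qed
  show conj: "quad_conj m (a + b * sqrt (real m)) = a - b * sqrt (real m)"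
    unfolding quad_conj_def
    by (rule the_equality) (use ab uniq in blast)+
  show "quad_norm m (a + b * sqrt (real m)) = a\<^sup>2 - real m * b\<^sup>2"
    unfolding quad_norm_def conj by (simp add: power2_eq_square algebra_simps)
qed

end

theory Submission
  imports Defs
begin

text \<open>
  A unit $\varepsilon = (T + U\sqrt m)/2$ of norm $-1$ satisfies
  $(\varepsilon + i)^2 = \varepsilon\,(T + 2i)$ with $T^2 + 4 = m U^2$. Extracting from $T + 2i$ a
  Gaussian square of norm $U^2$ shows that $\varepsilon\,\delta$ is a square in
  $\mathbb{Q}(\sqrt m, i)$ for some $\delta \in \mathbb{Z}[i]$ of norm exactly $m$, normalised to have odd
  real part if $m$ is odd. Let $\Delta = A + Bi$ be the product of the $\delta$'s for
  $m_1, \dots, m_k$. Its norm $m_1 \cdots m_k = w^2$ is a square, hence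
  $\sqrt\Delta = \sqrt{(w + A)/2} \pm i \sqrt{(w - A)/2}$. The product $(w + A)(w - A) = B^2$ is a
  square, so $w + A$ is a square times $\gcd(w + A, w - A)$, which divides $2w$; for odd $w$
  the normalisation removes the factor $2$. So $\sqrt\Delta \in K(i)$ for
  $K = \mathbb{Q}(\sqrt{p_1}, \dots, \sqrt{p_t})$, and the product of the units is a square in $K(i)$.
  Being real and positive, it is a square in $K$.
\<close>

section \<open>Subfields of the reals\<close>

text \<open>Serves two purposes: closure properties of the field \<open>K\<close>, and minimality of
  \<open>rat_adjoin\<close>. Since \<open>inverse 0 = 0\<close>, closure under inverses can be
  stated without a side condition.\<close>

locale real_subfield =
  fixes K :: "real set"
  assumes one_mem: "1 \<in> K"
    and add_mem: "x \<in> K \<Longrightarrow> y \<in> K \<Longrightarrow> x + y \<in> K"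
    and uminus_mem: "x \<in> K \<Longrightarrow> - x \<in> K"
    and mult_mem: "x \<in> K \<Longrightarrow> y \<in> K \<Longrightarrow> x * y \<in> K"
    and inverse_mem: "x \<in> K \<Longrightarrow> inverse x \<in> K"
begin

lemma diff_mem: "x \<in> K \<Longrightarrow> y \<in> K \<Longrightarrow> x - y \<in> K"
  using add_mem[of x "- y"] uminus_mem[of y] by simp

lemma divide_mem: "x \<in> K \<Longrightarrow> y \<in> K \<Longrightarrow> x / y \<in> K"
  by (simp add: divide_inverse mult_mem inverse_mem)

lemma zero_mem: "0 \<in> K"
  using diff_mem[OF one_mem one_mem] by simp

lemma of_nat_mem: "of_nat n \<in> K"
  by (induction n) (auto simp: zero_mem one_mem add_mem)

lemma of_int_mem: "of_int n \<in> K"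
  by (cases n rule: int_diff_cases) (simp add: diff_mem of_nat_mem)

text \<open>Square roots are multiplicative on naturals, so prime factors can be split off one at a
  time.\<close>

lemma sqrt_of_nat_mem:
  assumes "n > 0" "\<And>p. prime p \<Longrightarrow> p dvd n \<Longrightarrow> sqrt (real p) \<in> K"
  shows "sqrt (real n) \<in> K"
  using assms
proof (induction n rule: less_induct)
  case (less n)
  show ?case
  proof (cases "n = 1")
    case False
    then obtain p where p: "prime p" "p dvd n"
      using prime_factor_nat by blast
    then obtain l where l: "n = p * l" by auto
    have "l < n" "l > 0"
      using l less.prems(1) prime_gt_1_nat[OF p(1)] by auto
    moreover have "sqrt (real q) \<in> K" if "prime q" "q dvd l" for q
      using less.prems(2)[of q] that l by simp
    ultimately have "sqrt (real l) \<in> K"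
      using less.IH by blast
    with less.prems(2)[OF p] show ?thesis
      by (simp add: l real_sqrt_mult mult_mem)
  qed (simp add: one_mem)
qed

text \<open>This is \<open>K(i)\<close>: as \<open>K\<close> is a field of reals, \<open>1\<close>
  and \<open>i\<close> form a basis over \<open>K\<close>.\<close>

definition complexification :: "complex set" where
  "complexification = {z. Re z \<in> K \<and> Im z \<in> K}"

lemma complexification_mult:
  "z \<in> complexification \<Longrightarrow> w \<in> complexification \<Longrightarrow> z * w \<in> complexification"
  by (auto simp: complexification_def intro!: add_mem diff_mem mult_mem)

lemma complexification_divide:
  "z \<in> complexification \<Longrightarrow> w \<in> complexification \<Longrightarrow> z / w \<in> complexification"
  by (auto simp: complexification_def Re_divide Im_divide power2_eq_square
      intro!: add_mem diff_mem mult_mem divide_mem)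

lemma complexification_prod:
  "(\<And>i. i \<in> I \<Longrightarrow> f i \<in> complexification) \<Longrightarrow> prod f I \<in> complexification"
proof (induction I rule: infinite_finite_induct)
  case (insert x F)
  then show ?case by (auto intro!: complexification_mult)
qed (auto simp: complexification_def one_mem zero_mem)

lemma complexification_Complex:
  "x \<in> K \<Longrightarrow> y \<in> K \<Longrightarrow> Complex x y \<in> complexification"
  by (simp add: complexification_def)

text \<open>Descends from \<open>K(i)\<close> to \<open>K\<close>. A complex number with real square
  is real or purely imaginary, and in the second case the square is not positive.\<close>

lemma pos_square_in_complexification:
  assumes "z \<in> complexification" "complex_of_real x = z\<^sup>2" "x > 0"
  shows "\<exists>y\<in>K. x = y\<^sup>2"
proof -
  have re: "x = (Re z)\<^sup>2 - (Im z)\<^sup>2" and im: "Re z * Im z = 0"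
    using arg_cong[OF assms(2), of Re] arg_cong[OF assms(2), of Im]
    by (auto simp: power2_eq_square)
  have "Im z = 0"
  proof (rule ccontr)
    assume "Im z \<noteq> 0"
    with im re have "x = - (Im z)\<^sup>2" by simp
    with assms(3) show False by (smt (verit) zero_le_power2)
  qed
  with re assms(1) show ?thesis
    by (auto simp: complexification_def intro!: bexI[of _ "Re z"])
qed

end

section \<open>\<open>rat_adjoin S\<close> as the smallest real subfield containing
  \<open>S\<close>\<close>

lemma ring_of_type_algebra_ops:
  fixes x y :: "'a :: Fields.field"
  defines "R \<equiv> ring_of_type_algebra :: 'a ring"
  shows "\<one>\<^bsub>R\<^esub> = 1" "\<zero>\<^bsub>R\<^esub> = 0" "x \<oplus>\<^bsub>R\<^esub> y = x + y" "x \<otimes>\<^bsub>R\<^esub> y = x * y"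
    and "\<ominus>\<^bsub>R\<^esub> x = - x" "x \<noteq> 0 \<Longrightarrow> inv\<^bsub>R\<^esub> x = inverse x"
proof -
  interpret R: field R
    unfolding R_def by (rule field_from_type_algebra)
  show ops: "\<one>\<^bsub>R\<^esub> = 1" "\<zero>\<^bsub>R\<^esub> = 0" "x \<oplus>\<^bsub>R\<^esub> y = x + y" "x \<otimes>\<^bsub>R\<^esub> y = x * y" for x y
    by (simp_all add: R_def ring_of_type_algebra_def)
  have UNIV: "carrier R = UNIV"
    by (simp add: R_def ring_of_type_algebra_def)
  show "\<ominus>\<^bsub>R\<^esub> x = - x"
    using R.minus_equality[of "- x" x] by (simp add: ops UNIV)
  show "inv\<^bsub>R\<^esub> x = inverse x" if "x \<noteq> 0"
    using R.comm_inv_char[of x "inverse x"] that by (simp add: ops UNIV)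
qed

lemma rat_adjoin_real_subfield: "real_subfield (rat_adjoin S)"
proof -
  let ?R = "ring_of_type_algebra :: real ring"
  show ?thesis
  proof
    show "1 \<in> rat_adjoin S"
      using generate_field.one[of ?R S] by (simp add: rat_adjoin_def ring_of_type_algebra_ops)
    show "x + y \<in> rat_adjoin S" "x * y \<in> rat_adjoin S"
      if "x \<in> rat_adjoin S" "y \<in> rat_adjoin S" for x y
      using generate_field.eng_add[of x ?R S y] generate_field.eng_mult[of x ?R S y] that
      by (simp_all add: rat_adjoin_def ring_of_type_algebra_ops)
    show "- x \<in> rat_adjoin S" if "x \<in> rat_adjoin S" for x
      using generate_field.a_inv[of x ?R S] that by (simp add: rat_adjoin_def ring_of_type_algebra_ops)
    show "inverse x \<in> rat_adjoin S" if "x \<in> rat_adjoin S" for x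
      using generate_field.m_inv[of x ?R S] that
      by (cases "x = 0") (simp_all add: rat_adjoin_def ring_of_type_algebra_ops)
  qed
qed

lemma rat_adjoin_incl: "x \<in> S \<Longrightarrow> x \<in> rat_adjoin S"
  by (simp add: rat_adjoin_def generate_field.incl)

lemma rat_adjoin_minimal:
  assumes "real_subfield F" "S \<subseteq> F"
  shows "rat_adjoin S \<subseteq> F"
proof
  interpret F: real_subfield F by fact
  let ?R = "ring_of_type_algebra :: real ring"
  fix x assume "x \<in> rat_adjoin S"
  then have "x \<in> generate_field ?R S" by (simp add: rat_adjoin_def)
  then show "x \<in> F"
    by induction
      (use assms(2) F.one_mem F.add_mem F.mult_mem F.uminus_mem F.inverse_mem
        in \<open>auto simp: ring_of_type_algebra_ops\<close>)
qed

text \<open>The numbers \<open>a + b * sqrt m\<close> with rational \<open>a\<close>,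
  \<open>b\<close> already form a field, inverses being found by multiplying with the conjugate;
  minimality does the rest.\<close>

lemma rat_adjoin_sqrtE:
  assumes "x \<in> rat_adjoin {sqrt (real m)}"
  obtains a b where "a \<in> \<rat>" "b \<in> \<rat>" "x = a + b * sqrt (real m)"
proof -
  let ?s = "sqrt (real m)"
  let ?F = "{a + b * ?s |a b. a \<in> \<rat> \<and> b \<in> \<rat>}"
  have memI: "a + b * ?s \<in> ?F" if "a \<in> \<rat>" "b \<in> \<rat>" for a b
    using that by blast
  have ss: "?s * ?s = real m" by simp
  have "real_subfield ?F"
  proof
    show "1 \<in> ?F" using memI[of 1 0] by simp
    fix x assume "x \<in> ?F"
    then obtain a b where x: "x = a + b * ?s" and ab: "a \<in> \<rat>" "b \<in> \<rat>" by blast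
    have "- x = (- a) + (- b) * ?s" using x by simp
    then show "- x \<in> ?F" using memI[of "- a" "- b"] ab by simp
    show "inverse x \<in> ?F"
    proof (cases "a - b * ?s = 0")
      \<comment> \<open>\<open>m\<close> may be a perfect square here, so the conjugate of a nonzero
        \<open>x\<close> can vanish; then \<open>x = 2 * a\<close> is rational.\<close>
      case True
      then have "x = 2 * a" using x by simp
      then show ?thesis using memI[of "inverse (2 * a)" 0] ab by simp
    next
      case False
      define d where "d = a\<^sup>2 - real m * b\<^sup>2"
      have "x * (a - b * ?s) = d"
        by (simp add: x d_def algebra_simps power2_eq_square ss)
      then have "inverse x = (a - b * ?s) / d"
        using False by (cases "x = 0") (auto simp: field_simps)
      also have "\<dots> = a / d + (- (b / d)) * ?s"
        by (simp add: diff_divide_distrib)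
      also have "\<dots> \<in> ?F"
        using ab by (intro memI) (auto simp: d_def)
      finally show ?thesis .
    qed
    fix y assume "y \<in> ?F"
    then obtain c d where y: "y = c + d * ?s" and cd: "c \<in> \<rat>" "d \<in> \<rat>" by blast
    have "x + y = (a + c) + (b + d) * ?s" by (simp add: x y algebra_simps)
    also have "\<dots> \<in> ?F" using ab cd by (intro memI) auto
    finally show "x + y \<in> ?F" .
    have "x * y = (a * c + real m * b * d) + (a * d + b * c) * ?s"
      by (simp add: x y algebra_simps ss)
    also have "\<dots> \<in> ?F" using ab cd by (intro memI) auto
    finally show "x * y \<in> ?F" .
  qed
  moreover have "{?s} \<subseteq> ?F" using memI[of 0 1] by simp
  ultimately have "x \<in> ?F"
    using assms rat_adjoin_minimal by blast
  then show ?thesis using that by blast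
qed

section \<open>Units of norm $-1$\<close>

lemma poly_map_of_int_hom:
  fixes x :: "'a :: comm_ring_1"
  shows "poly (map_poly of_int (p + q)) x = poly (map_poly of_int p) x + poly (map_poly of_int q) x"
    and "poly (map_poly of_int (p * q)) x = poly (map_poly of_int p) x * poly (map_poly of_int q) x"
proof -
  have "map_poly of_int (p + q) = (map_poly of_int p + map_poly of_int q :: 'a poly)" for p q
    by (intro poly_eqI) (simp add: coeff_map_poly)
  then show add: "poly (map_poly of_int (p + q)) x
      = poly (map_poly of_int p) x + poly (map_poly of_int q) x" for p q
    by simp
  show "poly (map_poly of_int (p * q)) x = poly (map_poly of_int p) x * poly (map_poly of_int q) x"
    by (induction p) (simp_all add: map_poly_pCons map_poly_smult add algebra_simps)
qed

text \<open>
  Gauss's lemma: the primitive multiple of $X^2 - tX - 1$ divides a monic integer polynomial.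
\<close>

lemma algebraic_int_quadratic_trace:
  fixes x :: real
  assumes "algebraic_int x" "x \<notin> \<rat>" and t: "t \<in> \<rat>" and eq: "x\<^sup>2 = t * x + 1"
  shows "t \<in> \<int>"
proof -
  obtain a d :: int where td: "d > 0" "coprime a d" "t = of_int a / of_int d"
    using t by (auto elim!: Rats_cases')
  \<comment> \<open>This is \<open>d * (X^2 - t * X - 1)\<close>, with denominators cleared; it is
    primitive because \<open>a\<close> and \<open>d\<close> are coprime.\<close>
  define q where "q = [:- d, - a, d:]"
  obtain p where p: "poly (map_poly of_int p) x = 0" "lead_coeff p = 1"
    using assms(1) by (auto simp: algebraic_int_altdef_ipoly)
  have q0: "q \<noteq> 0" and dq: "degree q = 2" and lq: "lead_coeff q = d"
    using td(1) by (auto simp: q_def)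
  have cp: "Polynomial.content p = 1"
    using content_dvd_coeff[of p "degree p"] p(2) by (metis is_unit_content_iff)
  have cq: "Polynomial.content q = 1"
  proof -
    have "Polynomial.content q dvd - a" "Polynomial.content q dvd d"
      using content_dvd_coeff[of q 1] content_dvd_coeff[of q 2]
      by (simp_all add: q_def coeff_pCons numeral_2_eq_2)
    then have "is_unit (Polynomial.content q)"
      using td(2) by (metis coprime_common_divisor dvd_minus_iff)
    then show ?thesis by (simp only: is_unit_content_iff)
  qed
  have rq: "poly (map_poly of_int q) x = 0"
    using eq td by (simp add: q_def map_poly_pCons field_simps power2_eq_square)
  define r where "r = pseudo_mod p q"
  \<comment> \<open>Pseudo-division stays over the integers at the price of the factor
    \<open>c\<close>. The remainder is linear at most and vanishes at the irrational
    \<open>x\<close>, hence is zero.\<close>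
  obtain c s where cs: "c \<noteq> 0" "smult c p = q * s + r"
    using pseudo_mod(1)[OF q0, of p] by (auto simp: r_def)
  have dr: "degree r \<le> 1"
    using pseudo_mod(2)[OF q0, of p] dq by (auto simp: r_def)
  have "poly (map_poly of_int r) x = 0"
    using arg_cong[OF cs(2), of "\<lambda>p. poly (map_poly of_int p) x"] p(1) rq
    by (simp add: poly_map_of_int_hom map_poly_smult)
  moreover obtain b e where r: "r = [:b, e:]"
    using dr by (metis degree_pCons_eq_if degree_eq_zeroE le_zero_eq less_one not_less pCons_cases
        Suc_le_mono One_nat_def pCons_0_0)
  ultimately have be: "of_int e * x = - of_int b"
    by (simp add: map_poly_pCons algebra_simps)
  have "e = 0"
  proof (rule ccontr)
    assume "e \<noteq> 0"
    with be have "x = - of_int b / of_int e" by (simp add: field_simps)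
    also have "\<dots> \<in> \<rat>" by auto
    finally show False using assms(2) by simp
  qed
  with be r have "r = 0" by simp
  \<comment> \<open>Contents are multiplicative and \<open>p\<close>, \<open>q\<close> are
    primitive, so \<open>c\<close> can be cancelled. Then \<open>q\<close> divides the monic
    \<open>p\<close>, and its leading coefficient \<open>d\<close> is a unit.\<close>
  have "Polynomial.content s = \<bar>c\<bar>"
    using arg_cong[OF cs(2), of Polynomial.content] \<open>r = 0\<close> cp cq by (simp add: content_mult)
  then have "[:c:] dvd s"
    by (simp add: const_poly_dvd_iff_dvd_content)
  then obtain s' where "s = smult c s'"
    by (auto elim!: dvdE)
  with cs \<open>r = 0\<close> have "smult c p = smult c (q * s')" by simp
  with cs(1) have "p = q * s'" by (metis smult_cancel)
  then have "d * lead_coeff s' = 1"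
    using p(2) lq by (metis lead_coeff_mult)
  with td(1) have "d = 1"
    by (metis dvd_triv_left zdvd1_eq abs_of_pos)
  with td show ?thesis by simp
qed

text \<open>In lowest terms \<open>u = a / d\<close>, the square \<open>d^2\<close> divides
  \<open>m * a^2\<close> and is coprime to \<open>a\<close>, so it divides the square-free
  \<open>m\<close>.\<close>

lemma squarefree_mult_rat_square:
  fixes u :: real
  assumes "squarefree m" "u \<in> \<rat>" "real m * u\<^sup>2 \<in> \<int>"
  shows "u \<in> \<int>"
proof -
  obtain a d :: int where u: "d > 0" "coprime a d" "u = of_int a / of_int d"
    using assms(2) by (auto elim!: Rats_cases')
  obtain n where n: "real m * u\<^sup>2 = of_int n"
    using assms(3) by (auto elim: Ints_cases)
  then have "real m * (of_int a)\<^sup>2 = of_int n * (of_int d)\<^sup>2"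
    using u by (simp add: field_simps)
  then have "real_of_int (int m * a\<^sup>2) = real_of_int (n * d\<^sup>2)"
    by simp
  then have "int m * a\<^sup>2 = n * d\<^sup>2"
    by (simp only: of_int_eq_iff)
  then have "d\<^sup>2 dvd int m * a\<^sup>2" by simp
  then have "d\<^sup>2 dvd int m"
    using u(2) by (simp add: coprime_dvd_mult_left_iff coprime_commute)
  then have "(nat d)\<^sup>2 dvd m"
    using u(1) by (metis int_dvd_int_iff int_nat_eq less_imp_le of_nat_power)
  with assms(1) have "nat d dvd 1"
    unfolding squarefree_def by blast
  with u(1) have "d = 1" by simp
  with u show ?thesis by simp
qed

text \<open>\<open>T\<close> is the trace, an integer by Gauss's lemma because norm -1 gives
  \<open>e^2 = T * e + 1\<close>. The norm equation then makes \<open>m * (2 * b)^2\<close> an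
  integer, and square-freeness makes \<open>U = 2 * b\<close> one.\<close>

lemma unit_norm_minus_one:
  assumes m: "squarefree m" "m > 1"
    and e: "e \<in> quad_units m" "quad_norm m e = -1"
  obtains T U :: int where "e = (of_int T + of_int U * sqrt (real m)) / 2" "T\<^sup>2 + 4 = int m * U\<^sup>2"
proof -
  have e': "e \<in> rat_adjoin {sqrt (real m)}" "algebraic_int e"
    using e(1) by (auto simp: quad_units_def quad_integers_def)
  obtain a b where ab: "a \<in> \<rat>" "b \<in> \<rat>" "e = a + b * sqrt (real m)"
    using e'(1) by (rule rat_adjoin_sqrtE)
  have norm: "a\<^sup>2 - real m * b\<^sup>2 = -1"
    using quad_conj_norm_eq(2)[OF m ab(1,2)] e(2) ab(3) by simp
  \<comment> \<open>A rational element would have the nonnegative norm \<open>e^2\<close>.\<close>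
  have irr: "e \<notin> \<rat>"
  proof
    assume "e \<in> \<rat>"
    then have "quad_norm m e = e\<^sup>2"
      using quad_conj_norm_eq(2)[OF m, of e 0] by simp
    with e(2) show False by (smt (verit) zero_le_power2)
  qed
  have "e\<^sup>2 = (2 * a) * e + 1"
  proof -
    have "e\<^sup>2 = a\<^sup>2 + 2 * a * b * sqrt (real m) + real m * b\<^sup>2"
      by (simp add: ab(3) power2_eq_square algebra_simps)
    also have "\<dots> = (2 * a) * e + 1"
      using norm by (simp add: ab(3) power2_eq_square algebra_simps)
    finally show ?thesis .
  qed
  with e'(2) irr ab(1) have "2 * a \<in> \<int>"
    by (intro algebraic_int_quadratic_trace) auto
  then obtain T where T: "2 * a = of_int T" by (auto elim: Ints_cases)
  have TU: "real m * (2 * b)\<^sup>2 = of_int (T\<^sup>2 + 4)"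
    using norm T[symmetric] by (simp add: power2_eq_square algebra_simps)
  have "2 * b \<in> \<int>"
  proof (rule squarefree_mult_rat_square[OF m(1)])
    show "2 * b \<in> \<rat>" using ab(2) by simp
    show "real m * (2 * b)\<^sup>2 \<in> \<int>" unfolding TU by (rule Ints_of_int)
  qed
  then obtain U where U: "2 * b = of_int U" by (auto elim: Ints_cases)
  have "e = (of_int T + of_int U * sqrt (real m)) / 2"
    unfolding ab(3) T[symmetric] U[symmetric] by simp
  moreover have "real_of_int (T\<^sup>2 + 4) = real_of_int (int m * U\<^sup>2)"
    using TU unfolding U by simp
  then have "T\<^sup>2 + 4 = int m * U\<^sup>2"
    by (simp only: of_int_eq_iff)
  ultimately show ?thesis using that by blast
qed

section \<open>Gaussian integers\<close>

definition gauss_ints :: "complex set" where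
  "gauss_ints = {z. Re z \<in> \<int> \<and> Im z \<in> \<int>}"

lemma gauss_ints_closed:
  assumes "z \<in> gauss_ints" "w \<in> gauss_ints"
  shows "z + w \<in> gauss_ints" "z - w \<in> gauss_ints" "z * w \<in> gauss_ints"
    "- z \<in> gauss_ints" "cnj z \<in> gauss_ints"
  using assms by (auto simp: gauss_ints_def)

lemma gauss_ints_basic [simp]:
  "0 \<in> gauss_ints" "1 \<in> gauss_ints" "\<i> \<in> gauss_ints" "of_int k \<in> gauss_ints" "of_nat n \<in> gauss_ints"
  by (auto simp: gauss_ints_def)

lemma gauss_intsE:
  assumes "z \<in> gauss_ints"
  obtains a b :: int where "z = Complex (of_int a) (of_int b)"
  using assms by (auto simp: gauss_ints_def complex_eq_iff elim!: Ints_cases)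

lemma gauss_ints_cmod_sq: "z \<in> gauss_ints \<Longrightarrow> \<exists>n::nat. (cmod z)\<^sup>2 = real n"
proof -
  assume "z \<in> gauss_ints"
  then obtain a b :: int where "z = Complex (of_int a) (of_int b)" by (rule gauss_intsE)
  then have "(cmod z)\<^sup>2 = real (nat (a\<^sup>2 + b\<^sup>2))"
    by (simp add: cmod_power2)
  then show ?thesis ..
qed

text \<open>Rounding both coordinates leaves a squared distance of at most 1/2. This is what makes
  division with remainder work in \<open>Z[i]\<close>.\<close>

lemma gauss_ints_round: "\<exists>k\<in>gauss_ints. cmod (q - k) < 1"
proof -
  define k where "k = Complex (of_int (round (Re q))) (of_int (round (Im q)))"
  have "(Re (q - k))\<^sup>2 \<le> (1/2)\<^sup>2" "(Im (q - k))\<^sup>2 \<le> (1/2)\<^sup>2"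
    using of_int_round_abs_le[of "Re q"] of_int_round_abs_le[of "Im q"]
    by (auto simp: k_def abs_minus_commute simp flip: abs_le_square_iff)
  then have "(cmod (q - k))\<^sup>2 < 1\<^sup>2"
    unfolding cmod_power2 by (simp add: power2_eq_square)
  then have "cmod (q - k) < 1"
    by (rule power2_less_imp_less) simp
  moreover have "k \<in> gauss_ints"
    by (simp add: k_def gauss_ints_def)
  ultimately show ?thesis by blast
qed

text \<open>A nonzero element of least norm in the ideal generated by \<open>z\<close> and
  \<open>y\<close> divides every member of it: the remainder of a division lies in the ideal and has
  smaller norm, hence is zero.\<close>

lemma gauss_ints_bezout:
  assumes z: "z \<in> gauss_ints" and y: "y \<in> gauss_ints" "y \<noteq> 0"
  obtains g s t u v where "g \<noteq> 0" "g \<in> gauss_ints" "s \<in> gauss_ints" "t \<in> gauss_ints"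
    "u \<in> gauss_ints" "v \<in> gauss_ints" "g = s * z + t * y" "z = g * u" "y = g * v"
proof -
  define I where "I = {s * z + t * y |s t. s \<in> gauss_ints \<and> t \<in> gauss_ints}"
  have I_G: "w \<in> gauss_ints" if "w \<in> I" for w
    using that z y by (auto simp: I_def gauss_ints_closed)
  define N where "N w = nat \<lfloor>(cmod w)\<^sup>2\<rfloor>" for w
  have N: "(cmod w)\<^sup>2 = real (N w)" if "w \<in> gauss_ints" for w
    using gauss_ints_cmod_sq[OF that] by (auto simp: N_def)
  have zI: "z \<in> I" and yI: "y \<in> I"
    unfolding I_def by (rule CollectI, rule exI[of _ 1], rule exI[of _ 0], simp)
      (rule CollectI, rule exI[of _ 0], rule exI[of _ 1], simp)
  obtain g where g: "g \<in> I" "g \<noteq> 0" and min: "\<And>w. w \<in> I \<Longrightarrow> w \<noteq> 0 \<Longrightarrow> N g \<le> N w"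
    using ex_has_least_nat[of "\<lambda>w. w \<in> I \<and> w \<noteq> 0" y N] yI y(2) by blast
  obtain s t where st: "s \<in> gauss_ints" "t \<in> gauss_ints" "g = s * z + t * y"
    using g(1) by (auto simp: I_def)
  have dvd: "\<exists>k\<in>gauss_ints. w = g * k" if w: "w \<in> I" for w
  proof -
    obtain k where k: "k \<in> gauss_ints" "cmod (w / g - k) < 1"
      using gauss_ints_round by blast
    define \<rho> where "\<rho> = w - g * k"
    obtain a b where ab: "a \<in> gauss_ints" "b \<in> gauss_ints" "w = a * z + b * y"
      using w by (auto simp: I_def)
    have "\<rho> = (a - s * k) * z + (b - t * k) * y"
      by (simp add: \<rho>_def ab st algebra_simps)
    then have "\<rho> \<in> I"
      using ab st k(1) unfolding I_def by (blast intro: gauss_ints_closed)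
    have "\<rho> = g * (w / g - k)"
      using g(2) by (simp add: \<rho>_def algebra_simps)
    then have "cmod \<rho> < cmod g"
      using k(2) g(2) by (simp add: norm_mult)
    then have "(cmod \<rho>)\<^sup>2 < (cmod g)\<^sup>2"
      by (intro power_strict_mono) auto
    then have "N \<rho> < N g"
      using N[OF I_G[OF \<open>\<rho> \<in> I\<close>]] N[OF I_G[OF g(1)]] by simp
    with min[OF \<open>\<rho> \<in> I\<close>] have "\<rho> = 0" by force
    then show ?thesis using k(1) by (auto simp: \<rho>_def)
  qed
  show ?thesis
    using that g(2) I_G[OF g(1)] st dvd[OF zI] dvd[OF yI] by metis
qed

text \<open>Positive reals dividing each other in \<open>Z[i]\<close> are equal: on real parts the
  quotients are positive integers, so each number is at least the other. It turns two divisibilities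
  into an equality of norms.\<close>

lemma gauss_ints_real_unit:
  assumes "g \<in> gauss_ints" "h \<in> gauss_ints" "complex_of_real a = of_real b * g"
    "complex_of_real b = of_real a * h" "a > 0" "b > 0"
  shows "a = b"
proof -
  obtain i :: int where i: "Re g = of_int i"
    using assms(1) by (auto simp: gauss_ints_def elim: Ints_cases)
  obtain j :: int where j: "Re h = of_int j"
    using assms(2) by (auto simp: gauss_ints_def elim: Ints_cases)
  have ab: "b * of_int i = a" "a * of_int j = b"
    using arg_cong[OF assms(3)[symmetric], of Re] arg_cong[OF assms(4)[symmetric], of Re] i j
    by simp_all
  then have "b * of_int i > 0" "a * of_int j > 0"
    using assms(5,6) by linarith+
  then have "i > 0" "j > 0"
    using assms(5,6) by (simp_all add: zero_less_mult_iff)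
  then have "1 \<le> real_of_int i" "1 \<le> real_of_int j" by simp_all
  then have "b * 1 \<le> b * of_int i" "a * 1 \<le> a * of_int j"
    using assms(5,6) by (intro mult_left_mono; simp)+
  then show ?thesis unfolding ab by simp
qed

text \<open>
  With \<open>\<gamma> = gcd z y\<close>, the ideal generated by \<open>\<gamma> * cnj \<gamma>\<close> is \<open>y\<close> times the one generated by
  \<open>n * y\<close>, \<open>z\<close>, \<open>cnj z\<close> and \<open>y\<close>, which is everything by the last hypothesis.
\<close>

lemma gauss_ints_extract_square:
  fixes n y :: nat
  assumes z: "z \<in> gauss_ints" and y: "y > 0" and norm: "(cmod z)\<^sup>2 = real (n * y\<^sup>2)"
    and ef: "e \<in> gauss_ints" "f \<in> gauss_ints" "e * of_nat y + f * (z - cnj z) = 1"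
  obtains \<delta> \<gamma> where "\<delta> \<in> gauss_ints" "\<gamma> \<in> gauss_ints" "z = \<delta> * \<gamma>\<^sup>2"
    "(cmod \<gamma>)\<^sup>2 = real y" "(cmod \<delta>)\<^sup>2 = real n"
proof -
  let ?y = "of_nat y :: complex"
  have zz: "z * cnj z = of_nat n * ?y\<^sup>2"
    unfolding complex_norm_square[symmetric] norm by simp
  have y0: "?y \<noteq> 0" using y by simp
  obtain g s t u v where g0: "g \<noteq> 0"
    and G: "g \<in> gauss_ints" "s \<in> gauss_ints" "t \<in> gauss_ints" "u \<in> gauss_ints" "v \<in> gauss_ints"
    and g: "g = s * z + t * ?y" and zu: "z = g * u" and yv: "?y = g * v"
    by (rule gauss_ints_bezout[OF z gauss_ints_basic(5) y0])
  note closed = gauss_ints_closed G z ef(1,2)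
  have cg: "cnj g = cnj s * cnj z + cnj t * ?y"
    by (simp add: g)
  have ng: "complex_of_real ((cmod g)\<^sup>2) = g * cnj g"
    by (rule complex_norm_square)
  \<comment> \<open>First divisibility: \<open>y\<close> divides \<open>g * cnj g\<close>. Expanding
    the product, the only term without a visible \<open>y\<close> contains
    \<open>z * cnj z = n * y^2\<close>.\<close>
  have "complex_of_real ((cmod g)\<^sup>2)
      = of_real (real y) * (s * cnj s * of_nat n * ?y + s * cnj t * z + t * cnj s * cnj z + t * cnj t * ?y)"
  proof -
    have "g * cnj g = s * cnj s * (z * cnj z) + ?y * (s * cnj t * z + t * cnj s * cnj z + t * cnj t * ?y)"
      by (simp add: g algebra_simps)
    then show ?thesis
      unfolding ng zz by (simp add: algebra_simps power2_eq_square)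
  qed
  \<comment> \<open>Converse divisibility: the relation for \<open>e\<close> and \<open>f\<close> is
    multiplied by \<open>y\<close>. Since \<open>y\<close> is real, both \<open>g\<close> and
    \<open>cnj g\<close> divide it, so \<open>y * y\<close>, \<open>z * y\<close> and
    \<open>cnj z * y\<close> are all multiples of \<open>g * cnj g\<close>.\<close>
  moreover have "complex_of_real (real y) = of_real ((cmod g)\<^sup>2) * (e * v * cnj v + f * u * cnj v - f * cnj u * v)"
  proof -
    have yv': "?y = cnj g * cnj v"
      using arg_cong[OF yv, of cnj] by simp
    have zu': "cnj z = cnj g * cnj u"
      by (simp add: zu)
    have "?y = ?y * (e * ?y + f * (z - cnj z))"
      by (simp add: ef(3))
    also have "\<dots> = e * (?y * ?y) + f * (z * ?y) - f * (cnj z * ?y)"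
      by (simp add: algebra_simps)
    also have "?y * ?y = (g * v) * (cnj g * cnj v)"
      using yv yv' by metis
    also have "z * ?y = (g * u) * (cnj g * cnj v)"
      using zu yv' by metis
    also have "cnj z * ?y = (cnj g * cnj u) * (g * v)"
      using zu' yv by metis
    finally show ?thesis
      unfolding ng by (simp add: algebra_simps)
  qed
  moreover have "(cmod g)\<^sup>2 > 0" "real y > 0" using g0 y by auto
  ultimately have gy: "(cmod g)\<^sup>2 = real y"
    by (intro gauss_ints_real_unit) (auto intro!: closed)
  then have gcg: "g * cnj g = ?y" using ng by simp
  \<comment> \<open>The quotient \<open>z / g^2\<close> equals \<open>z * (cnj g)^2 / y^2\<close>,
    as \<open>g * cnj g = y\<close>. Expanding \<open>cnj g = cnj s * cnj z + cnj t * y\<close> and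
    using \<open>z * cnj z = n * y^2\<close> cancels \<open>y^2\<close> and leaves this Gaussian
    integer.\<close>
  define \<delta> where "\<delta> = of_nat n * (cnj s)\<^sup>2 * cnj z + 2 * of_nat n * cnj s * cnj t * ?y + (cnj t)\<^sup>2 * z"
  have "\<delta> = of_int (int n) * (cnj s * cnj s) * cnj z + of_int (2 * int n) * cnj s * cnj t * ?y + cnj t * cnj t * z"
    by (simp add: \<delta>_def power2_eq_square)
  then have dG: "\<delta> \<in> gauss_ints" by (auto intro!: closed simp del: of_int_mult)
  have "z * (cnj g)\<^sup>2 = (z * cnj z) * ((cnj s)\<^sup>2 * cnj z + 2 * cnj s * cnj t * ?y) + (cnj t)\<^sup>2 * z * ?y\<^sup>2"
    by (simp add: cg power2_eq_square algebra_simps)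
  also have "\<dots> = \<delta> * ?y\<^sup>2"
    unfolding zz by (simp add: \<delta>_def algebra_simps)
  also have "\<dots> = \<delta> * g\<^sup>2 * (cnj g)\<^sup>2"
    by (simp add: power_mult_distrib flip: gcg)
  finally have zd: "z = \<delta> * g\<^sup>2" using g0 by simp
  have "(cmod z)\<^sup>2 = (cmod \<delta>)\<^sup>2 * ((cmod g)\<^sup>2)\<^sup>2"
    by (simp add: zd norm_mult norm_power power_mult_distrib)
  then have "(cmod \<delta>)\<^sup>2 = real n"
    using norm y by (simp add: gy)
  with dG G(1) zd gy show ?thesis by (rule that)
qed

text \<open>Here \<open>z - cnj z = 2 * b * i\<close> divides 4 in \<open>Z[i]\<close> because
  \<open>b\<close> divides 2, and 4 is coprime to the odd \<open>y\<close>. So \<open>y\<close> and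
  \<open>z - cnj z\<close> generate the unit ideal.\<close>

lemma gauss_ints_extract_square_odd:
  fixes n y :: nat and a b :: int
  assumes y: "odd y" and norm: "a\<^sup>2 + b\<^sup>2 = int (n * y\<^sup>2)" and b: "b dvd 2"
  obtains c d u v :: int where "Complex a b = Complex c d * (Complex u v)\<^sup>2"
    "c\<^sup>2 + d\<^sup>2 = int n" "u\<^sup>2 + v\<^sup>2 = int y"
proof -
  define z where "z = Complex a b"
  have zG: "z \<in> gauss_ints" by (simp add: z_def gauss_ints_def)
  have nz: "(cmod z)\<^sup>2 = real (n * y\<^sup>2)"
    using arg_cong[OF norm, of real_of_int] by (simp add: z_def cmod_power2)
  obtain k where k: "2 = b * k" using b ..
  have "coprime (int y) 4"
    using y coprime_power_right_iff[of "int y" 2 2] by simp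
  then obtain p q where pq: "p * int y + q * 4 = 1"
    by (metis bezout_int coprime_iff_gcd_eq_1)
  define e f :: complex where "e = of_int p" and "f = - \<i> * of_int (q * k)"
  have "f * (z - cnj z) = of_int (q * k) * of_int (2 * b)"
    by (simp add: f_def z_def complex_eq_iff)
  also have "\<dots> = of_int (q * (2 * (b * k)))" by simp
  also have "\<dots> = of_int (q * 4)" unfolding k[symmetric] by simp
  finally have "e * of_nat y + f * (z - cnj z) = of_int (p * int y + q * 4)"
    by (simp add: e_def)
  then have ef: "e * of_nat y + f * (z - cnj z) = 1" by (simp add: pq)
  have "e \<in> gauss_ints" "f \<in> gauss_ints"
    by (simp_all add: e_def f_def gauss_ints_def)
  then obtain \<delta> \<gamma> where dg: "\<delta> \<in> gauss_ints" "\<gamma> \<in> gauss_ints" "z = \<delta> * \<gamma>\<^sup>2"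
    "(cmod \<gamma>)\<^sup>2 = real y" "(cmod \<delta>)\<^sup>2 = real n"
    using gauss_ints_extract_square[OF zG _ nz _ _ ef] y by (auto simp: odd_pos)
  obtain c d where cd: "\<delta> = Complex (of_int c) (of_int d)" using dg(1) by (rule gauss_intsE)
  obtain u v where uv: "\<gamma> = Complex (of_int u) (of_int v)" using dg(2) by (rule gauss_intsE)
  have "real_of_int (u\<^sup>2 + v\<^sup>2) = real_of_int (int y)" "real_of_int (c\<^sup>2 + d\<^sup>2) = real_of_int (int n)"
    using dg(4,5) by (simp_all add: cd uv cmod_power2)
  then have "u\<^sup>2 + v\<^sup>2 = int y" "c\<^sup>2 + d\<^sup>2 = int n"
    by (simp_all only: of_int_eq_iff)
  with dg(3) show ?thesis
    unfolding z_def cd uv by (intro that)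
qed

section \<open>Square roots in $K(i)$\<close>

context real_subfield
begin

text \<open>Once \<open>T + 2i = \<delta> * \<gamma>^2\<close>, dividing
  \<open>(e + i)^2 = e * (T + 2i)\<close> by \<open>\<gamma>^2\<close> gives the claim. For odd
  \<open>T\<close> the extraction applies directly; for even \<open>T\<close> it applies to
  \<open>T/2 + i\<close>, and the remaining factor 2 is absorbed afterwards.\<close>

lemma unit_times_gauss_int_square:
  fixes T U :: int
  assumes sqrt: "sqrt (real m) \<in> K" and m: "squarefree m"
    and e: "e = (of_int T + of_int U * sqrt (real m)) / 2" and TU: "T\<^sup>2 + 4 = int m * U\<^sup>2"
  shows "\<exists>c d :: int. c\<^sup>2 + d\<^sup>2 = int m \<and> (odd m \<longrightarrow> odd c) \<and>
           (\<exists>\<zeta>\<in>complexification. of_real e * Complex c d = \<zeta>\<^sup>2)"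
proof -
  have eK: "e \<in> K"
    unfolding e using sqrt of_int_mem[of 2] by (auto intro!: divide_mem add_mem mult_mem of_int_mem)
  have "e\<^sup>2 = of_int T * e + 1"
  proof -
    have "4 * e\<^sup>2 = (of_int T)\<^sup>2 + 2 * of_int T * of_int U * sqrt (real m) + of_int (int m * U\<^sup>2)"
      by (simp add: e power2_eq_square algebra_simps)
    also have "\<dots> = 4 * (of_int T * e + 1)"
      unfolding TU[symmetric] by (simp add: e power2_eq_square algebra_simps)
    finally show ?thesis by simp
  qed
  then have key: "(Complex e 1)\<^sup>2 = of_real e * Complex T 2"
    by (simp add: complex_eq_iff power2_eq_square algebra_simps)
  have eC: "Complex e 1 \<in> complexification"
    using eK one_mem by (rule complexification_Complex)
  have intC: "Complex (of_int a) (of_int b) \<in> complexification" for a b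
    by (intro complexification_Complex of_int_mem)
  define y where "y = nat \<bar>U\<bar>"
  have Uy: "U\<^sup>2 = (int y)\<^sup>2" by (simp add: y_def)
  show ?thesis
  proof (cases "odd T")
    case True
    then have "odd (int m * (int y)\<^sup>2)"
      using TU unfolding Uy by (metis even_add even_numeral even_power pos2)
    then have "odd y" by simp
    moreover have "T\<^sup>2 + 2\<^sup>2 = int (m * y\<^sup>2)" using TU Uy by simp
    ultimately obtain c d u v :: int where
      "Complex (of_int T) (of_int 2) = Complex c d * (Complex u v)\<^sup>2"
      and cd: "c\<^sup>2 + d\<^sup>2 = int m" "u\<^sup>2 + v\<^sup>2 = int y"
      by (rule gauss_ints_extract_square_odd[OF _ _ dvd_refl])
    then have T2: "Complex T 2 = Complex c d * (Complex u v)\<^sup>2" by simp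
    \<comment> \<open>Real parts modulo 2: an odd \<open>T\<close> forces \<open>c\<close> to be
      odd.\<close>
    have "real_of_int T = of_int (c * (u\<^sup>2 - v\<^sup>2) - 2 * d * u * v)"
      using arg_cong[OF T2, of Re] by (simp add: power2_eq_square algebra_simps)
    then have "T = c * (u\<^sup>2 - v\<^sup>2) - 2 * d * u * v" by (simp only: of_int_eq_iff)
    then have "odd c" using True by auto
    have g0: "Complex u v \<noteq> 0"
      using cd(2) \<open>odd y\<close> by (auto simp: complex_eq_iff)
    have "of_real e * Complex c d = (Complex e 1 / Complex u v)\<^sup>2"
      unfolding power_divide key T2 using g0 by simp
    then show ?thesis
      using cd(1) \<open>odd c\<close> eC intC complexification_divide by blast
  next
    case False
    then obtain x where x: "T = 2 * x" by auto
    have xU: "4 * (x\<^sup>2 + 1) = int (m * y\<^sup>2)"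
      using TU Uy by (simp add: x power_mult_distrib)
    \<comment> \<open>If \<open>y\<close> were odd, 4 would divide the square-free
      \<open>m\<close>.\<close>
    have "even y"
    proof (rule ccontr)
      assume "odd y"
      have "4 dvd int (m * y\<^sup>2)" unfolding xU[symmetric] by (rule dvd_triv_left)
      then have "4 dvd m * y\<^sup>2" by (metis int_dvd_int_iff of_nat_numeral)
      moreover have "coprime 4 (y\<^sup>2)"
        using \<open>odd y\<close> coprime_power_left_iff[of 2 2 "y\<^sup>2"] by simp
      ultimately have "2\<^sup>2 dvd m" by (simp add: coprime_dvd_mult_left_iff)
      then have "2 dvd (1 :: nat)" using m unfolding squarefree_def by blast
      then show False by simp
    qed
    then obtain l where l: "y = 2 * l" by auto
    have xl: "x\<^sup>2 + 1 = int (m * l\<^sup>2)"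
      using xU by (simp add: l power_mult_distrib)
    \<comment> \<open>The extraction needs an odd \<open>l\<close>; an even one would make
      \<open>x^2 + 1\<close> divisible by 4, but squares are 0 or 1 modulo 4.\<close>
    have "odd l"
    proof
      assume "even l"
      then have "4 dvd x\<^sup>2 + 1"
        unfolding xl by (auto simp: power_mult_distrib)
      moreover have "x\<^sup>2 mod 4 = 0 \<or> x\<^sup>2 mod 4 = 1"
      proof (cases "even x")
        case True
        then show ?thesis by (auto simp: power_mult_distrib)
      next
        case False
        then obtain j where "x = 2 * j + 1" by (auto elim: oddE)
        then have "x\<^sup>2 = 4 * (j\<^sup>2 + j) + 1" by (simp add: power2_eq_square algebra_simps)
        then show ?thesis by presburger
      qed
      ultimately show False by presburger
    qed
    moreover have "x\<^sup>2 + 1\<^sup>2 = int (m * l\<^sup>2)" using xl by simp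
    ultimately obtain c d u v :: int where
      "Complex (of_int x) (of_int 1) = Complex c d * (Complex u v)\<^sup>2"
      and cd: "c\<^sup>2 + d\<^sup>2 = int m" "u\<^sup>2 + v\<^sup>2 = int l"
      by (rule gauss_ints_extract_square_odd[OF _ _ one_dvd])
    then have x1: "Complex x 1 = Complex c d * (Complex u v)\<^sup>2" by simp
    \<comment> \<open>The factor \<open>-i\<close> coming from 2 will turn \<open>c + d * i\<close>
      into \<open>d - c * i\<close>, so it is \<open>d\<close> that must be odd. The imaginary part
      of the factorization shows this.\<close>
    have "odd d" if "odd m"
    proof -
      have "real_of_int 1 = of_int (d * (u\<^sup>2 - v\<^sup>2) + 2 * c * u * v)"
        using arg_cong[OF x1, of Im] by (simp add: power2_eq_square algebra_simps)
      then have "1 = d * (u\<^sup>2 - v\<^sup>2) + 2 * c * u * v" by (simp only: of_int_eq_iff)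
      then show ?thesis by (metis even_add even_mult_iff even_numeral odd_one)
    qed
    have g0: "Complex u v \<noteq> 0"
      using cd(2) \<open>odd l\<close> by (auto simp: complex_eq_iff)
    have "Complex T 2 = 2 * Complex x 1"
      by (simp add: x complex_eq_iff)
    \<comment> \<open>since \<open>2 = - \<i> * (1 + \<i>)\<^sup>2\<close>\<close>
    also have "\<dots> = Complex d (- c) * (Complex 1 1 * Complex u v)\<^sup>2"
    proof -
      have "2 * Complex c d = Complex d (- c) * (Complex 1 1)\<^sup>2"
        by (simp add: complex_eq_iff power2_eq_square)
      then show ?thesis unfolding x1 power_mult_distrib by (simp only: mult.assoc[symmetric])
    qed
    finally have T2: "Complex T 2 = Complex d (- c) * (Complex 1 1 * Complex u v)\<^sup>2" .
    have "Complex 1 1 \<noteq> 0" by (simp add: complex_eq_iff)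
    then have "of_real e * Complex d (- c) = (Complex e 1 / (Complex 1 1 * Complex u v))\<^sup>2"
      unfolding power_divide key T2 using g0 by simp
    moreover have "Complex e 1 / (Complex 1 1 * Complex u v) \<in> complexification"
      using eC intC[of 1 1] intC[of u v] by (intro complexification_divide complexification_mult) auto
    moreover have "d\<^sup>2 + (- c)\<^sup>2 = int m" using cd(1) by simp
    ultimately show ?thesis using \<open>odd m \<Longrightarrow> odd d\<close>
      by (intro exI[of _ d] exI[of _ "- c"]) auto
  qed
qed

text \<open>After division by the gcd \<open>g\<close>, two coprime factors have a square product,
  so each is a square. Hence \<open>sqrt r\<close> is an integer times \<open>sqrt g\<close>, and
  \<open>g\<close> divides \<open>r + s\<close>.\<close>

lemma sqrt_mem_of_mult_square:
  fixes r s b :: nat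
  assumes rs: "r * s = b\<^sup>2" "r + s > 0"
    and K: "\<And>p. prime p \<Longrightarrow> p dvd r + s \<Longrightarrow> sqrt (real p) \<in> K"
  shows "sqrt (real r) \<in> K"
proof (cases "r = 0 \<or> s = 0")
  \<comment> \<open>If \<open>s = 0\<close>, then \<open>r\<close> is the sum \<open>r + s\<close>,
    and all its primes are covered by the hypothesis.\<close>
  case True
  then show ?thesis
    using sqrt_of_nat_mem[of r] rs K by (cases "r = 0") (auto simp: zero_mem)
next
  case False
  define g where "g = gcd r s"
  have "g > 0" using False by (simp add: g_def)
  then obtain r' s' where r: "r = r' * g" and s: "s = s' * g" and cop: "coprime r' s'"
    using gcd_coprime_exists[of r s] unfolding g_def by blast
  have "g dvd r + s" unfolding r s by (metis dvd_add dvd_triv_right)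
  then have gK: "sqrt (real g) \<in> K"
    using sqrt_of_nat_mem[OF \<open>g > 0\<close>] K dvd_trans by blast
  have "g\<^sup>2 * (r' * s') = r * s"
    by (simp add: r s power2_eq_square)
  then have "is_square (g\<^sup>2 * (r' * s'))"
    by (simp add: rs(1))
  then have "is_square (r' * s')"
    using is_nth_power_mult_cancel_left[of 2 "g\<^sup>2" "r' * s'"] \<open>g > 0\<close> by simp
  then have "is_square r'"
    using is_nth_power_mult_coprime_natD(1)[OF cop] False r s by auto
  then obtain a where "r' = a\<^sup>2" by (auto elim: is_nth_powerE)
  then have "sqrt (real r) = real a * sqrt (real g)"
    by (simp add: r real_sqrt_mult)
  then show ?thesis using gK of_nat_mem mult_mem by simp
qed

text \<open>The modulus of \<open>A + B * i\<close> is \<open>w\<close>, so the coordinates of its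
  root are, up to sign, the square roots of \<open>(w + A) / 2\<close> and
  \<open>(w - A) / 2\<close>.\<close>

lemma csqrt_mem_complexification:
  fixes A B :: int and w :: nat
  assumes AB: "A\<^sup>2 + B\<^sup>2 = (int w)\<^sup>2" and w: "w > 0" and odd: "odd w \<longrightarrow> odd A"
    and K: "\<And>p. prime p \<Longrightarrow> p dvd w \<Longrightarrow> sqrt (real p) \<in> K"
  shows "csqrt (Complex A B) \<in> complexification"
proof -
  have "A\<^sup>2 \<le> (int w)\<^sup>2" using AB by (smt (verit) zero_le_power2)
  then have "\<bar>A\<bar> \<le> int w" by (metis abs_le_square_iff abs_of_nat)
  \<comment> \<open>Stated for a general \<open>a\<close> so that it serves for both
    \<open>A\<close> and \<open>- A\<close>.\<close>
  have sq: "sqrt ((real w + of_int a) / 2) \<in> K"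
    if a: "\<bar>a\<bar> \<le> int w" "a\<^sup>2 + B\<^sup>2 = (int w)\<^sup>2" "odd w \<longrightarrow> odd a" for a :: int
  proof (cases "odd w")
    \<comment> \<open>Both \<open>w + a\<close> and \<open>w - a\<close> are even by the parity
      normalization. Their halves have sum \<open>w\<close> and product \<open>(B / 2)^2\<close>, so
      only primes dividing \<open>w\<close> are required.\<close>
    case True
    then have "even (int w + a)" "even (int w - a)" using a(3) by auto
    then obtain r s where rs: "int w + a = 2 * r" "int w - a = 2 * s"
      unfolding dvd_def by blast
    have "r \<ge> 0" "s \<ge> 0" using rs a(1) by auto
    have rsw: "r + s = int w" using rs by simp
    have "4 * (r * s) = (int w + a) * (int w - a)" by (simp add: rs)
    also have "\<dots> = B\<^sup>2" using a(2) by (simp add: power2_eq_square algebra_simps)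
    finally have B: "4 * (r * s) = B\<^sup>2" .
    then have "even (B\<^sup>2)" by (metis dvd_triv_left dvd_mult2 even_numeral)
    then obtain b where b: "B = 2 * b" by auto
    have "r * s = b\<^sup>2" using B by (simp add: b power_mult_distrib)
    then have "int (nat r * nat s) = int ((nat \<bar>b\<bar>)\<^sup>2)"
      using \<open>r \<ge> 0\<close> \<open>s \<ge> 0\<close> by simp
    then have "nat r * nat s = (nat \<bar>b\<bar>)\<^sup>2" by (simp only: of_nat_eq_iff)
    moreover have "nat r + nat s = w" using rsw \<open>r \<ge> 0\<close> \<open>s \<ge> 0\<close> by simp
    ultimately have "sqrt (real (nat r)) \<in> K"
      using sqrt_mem_of_mult_square[of "nat r" "nat s" "nat \<bar>b\<bar>"] K w by simp
    moreover have "(real w + of_int a) / 2 = real (nat r)"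
      using arg_cong[OF rs(1), of real_of_int] \<open>r \<ge> 0\<close> by simp
    ultimately show ?thesis by simp
  next
    \<comment> \<open>Now 2 divides \<open>w\<close>, so \<open>sqrt 2\<close> is in
      \<open>K\<close> and no halving is necessary: \<open>w + a\<close> and \<open>w - a\<close>
      have sum \<open>2 * w\<close> and product \<open>B^2\<close>.\<close>
    case False
    then have K2: "sqrt 2 \<in> K" using K[of 2] by simp
    define r s where "r = nat (int w + a)" and "s = nat (int w - a)"
    have ir: "int r = int w + a" and js: "int s = int w - a"
      using a(1) by (simp_all add: r_def s_def)
    have "int (r * s) = int ((nat \<bar>B\<bar>)\<^sup>2)"
      using a(2) by (simp add: ir js power2_eq_square algebra_simps)
    then have "r * s = (nat \<bar>B\<bar>)\<^sup>2" by (simp only: of_nat_eq_iff)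
    moreover have rsw: "r + s = 2 * w" using ir js by linarith
    moreover have "sqrt (real p) \<in> K" if "prime p" "p dvd r + s" for p
    proof (cases "p dvd w")
      case False
      with that rsw have "p dvd 2" by (metis prime_dvd_mult_iff)
      then have "p = 2" using that(1) by (metis primes_dvd_imp_eq two_is_prime_nat)
      then show ?thesis using K2 by simp
    qed (use K that in blast)
    ultimately have "sqrt (real r) \<in> K"
      using sqrt_mem_of_mult_square[of r s "nat \<bar>B\<bar>"] w by simp
    moreover have "real w + of_int a = real r"
      using arg_cong[OF ir, of real_of_int] by simp
    ultimately show ?thesis using K2 by (simp add: real_sqrt_divide divide_mem)
  qed
  have "cmod (Complex A B) = real w"
  proof -
    have "(cmod (Complex A B))\<^sup>2 = (real w)\<^sup>2"
      using arg_cong[OF AB, of real_of_int] by (simp add: cmod_power2)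
    then show ?thesis by simp
  qed
  moreover have "sqrt ((real w + A) / 2) \<in> K" "sqrt ((real w - A) / 2) \<in> K"
    using sq[of A] sq[of "- A"] \<open>\<bar>A\<bar> \<le> int w\<close> AB odd by auto
  ultimately show ?thesis
    using one_mem by (auto simp: csqrt.code complexification_def sgn_if intro!: mult_mem uminus_mem)
qed

end

section \<open>Multiplying the Gaussian factors and concluding\<close>

lemma gauss_int_prod_parity:
  fixes c d :: "'a \<Rightarrow> int" and m :: "'a \<Rightarrow> nat"
  assumes "finite I"
    and "\<And>i. i \<in> I \<Longrightarrow> (c i)\<^sup>2 + (d i)\<^sup>2 = int (m i) \<and> (odd (m i) \<longrightarrow> odd (c i))"
  shows "\<exists>A B :: int. (\<Prod>i\<in>I. Complex (c i) (d i)) = Complex A B \<and>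
           A\<^sup>2 + B\<^sup>2 = int (\<Prod>i\<in>I. m i) \<and> (odd (\<Prod>i\<in>I. m i) \<longrightarrow> odd A)"
  using assms
proof (induction I rule: finite_induct)
  case empty
  then show ?case
    by (intro exI[of _ 1] exI[of _ 0]) (simp add: complex_eq_iff)
next
  case (insert x F)
  then obtain A B :: int where AB: "(\<Prod>i\<in>F. Complex (c i) (d i)) = Complex A B"
    "A\<^sup>2 + B\<^sup>2 = int (\<Prod>i\<in>F. m i)" "odd (\<Prod>i\<in>F. m i) \<longrightarrow> odd A" by force
  have x: "(c x)\<^sup>2 + (d x)\<^sup>2 = int (m x)" "odd (m x) \<longrightarrow> odd (c x)"
    using insert.prems by auto
  let ?A = "c x * A - d x * B" and ?B = "c x * B + d x * A"
  have "(\<Prod>i\<in>insert x F. Complex (c i) (d i)) = Complex ?A ?B"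
    using insert.hyps AB(1) by (simp add: complex_eq_iff)
  moreover have "?A\<^sup>2 + ?B\<^sup>2 = ((c x)\<^sup>2 + (d x)\<^sup>2) * (A\<^sup>2 + B\<^sup>2)"
    by (simp add: power2_eq_square algebra_simps)
  then have "?A\<^sup>2 + ?B\<^sup>2 = int (\<Prod>i\<in>insert x F. m i)"
    using insert.hyps unfolding x AB(2) by simp
  moreover have "odd ?A" if "odd (\<Prod>i\<in>insert x F. m i)"
  proof -
    have om: "odd (m x)" "odd (\<Prod>i\<in>F. m i)" using that insert.hyps by auto
    then have "odd (c x)" "odd A" using x(2) AB(3) by auto
    \<comment> \<open>An odd sum of two squares with \<open>c x\<close> odd has \<open>d x\<close>
      even, so \<open>c x * A - d x * B\<close> inherits oddness from \<open>c x\<close> and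
      \<open>A\<close>.\<close>
    moreover have "even (d x)"
      using arg_cong[OF x(1), of even] om(1) \<open>odd (c x)\<close> by simp
    ultimately show ?thesis by simp
  qed
  ultimately show ?case by blast
qed

theorem theorem6p1:
  fixes k :: nat and m :: "nat \<Rightarrow> nat" and \<epsilon> :: "nat \<Rightarrow> real"
  assumes "\<And>i. i \<in> {1..k} \<Longrightarrow> squarefree (m i) \<and> m i > 1"
    and "\<And>i. i \<in> {1..k} \<Longrightarrow> pos_fundamental_unit (m i) (\<epsilon> (m i))"
    and "\<And>i. i \<in> {1..k} \<Longrightarrow> quad_norm (m i) (\<epsilon> (m i)) = -1"
    and "is_square (\<Prod>i\<in>{1..k}. m i)"
  shows "\<exists>y \<in> rat_adjoin ((\<lambda>p. sqrt (real p)) ` prime_factors (\<Prod>i\<in>{1..k}. m i)).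
           (\<Prod>i\<in>{1..k}. \<epsilon> (m i)) = y\<^sup>2"
proof -
  define M where "M = (\<Prod>i\<in>{1..k}. m i)"
  define K where "K = rat_adjoin ((\<lambda>p. sqrt (real p)) ` prime_factors M)"
  interpret real_subfield K
    unfolding K_def by (rule rat_adjoin_real_subfield)
  have M0: "M > 0"
    unfolding M_def by (intro prod_pos) (use assms(1) in force)
  \<comment> \<open>Positivity of \<open>M\<close> matters: \<open>prime_factors\<close> of 0 is
    empty, although every prime divides 0.\<close>
  have primeK: "sqrt (real p) \<in> K" if "prime p" "p dvd M" for p
    unfolding K_def using that M0 by (intro rat_adjoin_incl imageI) (simp add: prime_factors_dvd)
  have "\<exists>c d :: int. c\<^sup>2 + d\<^sup>2 = int (m i) \<and> (odd (m i) \<longrightarrow> odd c) \<and>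
          (\<exists>\<zeta>\<in>complexification. of_real (\<epsilon> (m i)) * Complex c d = \<zeta>\<^sup>2)" if i: "i \<in> {1..k}" for i
  proof -
    have m: "squarefree (m i)" "m i > 1" using assms(1)[OF i] by auto
    have "m i dvd M" unfolding M_def using i by (intro dvd_prodI) auto
    then have "sqrt (real (m i)) \<in> K"
      using sqrt_of_nat_mem[of "m i"] m(2) primeK dvd_trans by (metis less_trans zero_less_one)
    moreover have "\<epsilon> (m i) \<in> quad_units (m i)"
      using assms(2)[OF i] by (simp add: pos_fundamental_unit_def)
    then obtain T U where "\<epsilon> (m i) = (of_int T + of_int U * sqrt (real (m i))) / 2"
      "T\<^sup>2 + 4 = int (m i) * U\<^sup>2"
      using unit_norm_minus_one[OF m] assms(3)[OF i] by blast
    ultimately show ?thesis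
      using unit_times_gauss_int_square m(1) by blast
  qed
  then obtain c d \<zeta> where cd: "\<And>i. i \<in> {1..k} \<Longrightarrow>
      (c i)\<^sup>2 + (d i)\<^sup>2 = int (m i) \<and> (odd (m i) \<longrightarrow> odd (c i :: int))"
    and \<zeta>: "\<And>i. i \<in> {1..k} \<Longrightarrow> \<zeta> i \<in> complexification"
      "\<And>i. i \<in> {1..k} \<Longrightarrow> of_real (\<epsilon> (m i)) * Complex (c i) (d i) = (\<zeta> i)\<^sup>2"
    by metis
  obtain A B :: int where AB: "(\<Prod>i\<in>{1..k}. Complex (c i) (d i)) = Complex A B"
    "A\<^sup>2 + B\<^sup>2 = int M" "odd M \<longrightarrow> odd A"
    using gauss_int_prod_parity[of "{1..k}" c d m] cd unfolding M_def by auto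
  obtain w where w: "M = w\<^sup>2"
    using assms(4) unfolding M_def by (auto elim: is_nth_powerE)
  have \<rho>: "csqrt (Complex A B) \<in> complexification"
  proof (rule csqrt_mem_complexification)
    show "A\<^sup>2 + B\<^sup>2 = (int w)\<^sup>2" using AB(2) by (simp add: w)
    show "w > 0" "odd w \<longrightarrow> odd A" using M0 AB(3) by (auto simp: w)
    show "sqrt (real p) \<in> K" if "prime p" "p dvd w" for p
      using that by (intro primeK) (auto simp: w power2_eq_square)
  qed
  have AB0: "Complex A B \<noteq> 0"
    using AB(2) M0 by (auto simp: complex_eq_iff)
  have "complex_of_real (\<Prod>i\<in>{1..k}. \<epsilon> (m i)) * Complex A B = (\<Prod>i\<in>{1..k}. \<zeta> i)\<^sup>2"
    unfolding AB(1)[symmetric] of_real_prod prod.distrib[symmetric] prod_power_distrib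
    using \<zeta>(2) by (intro prod.cong) auto
  \<comment> \<open>The product of the Gaussian factors is nonzero and is the square of its
    \<open>csqrt\<close>, which lies in \<open>K(i)\<close>; dividing by it leaves the units
    alone.\<close>
  then have "complex_of_real (\<Prod>i\<in>{1..k}. \<epsilon> (m i)) = ((\<Prod>i\<in>{1..k}. \<zeta> i) / csqrt (Complex A B))\<^sup>2"
    using AB0 by (simp add: power_divide nonzero_eq_divide_eq del: of_real_prod)
  moreover have "(\<Prod>i\<in>{1..k}. \<zeta> i) / csqrt (Complex A B) \<in> complexification"
    using \<zeta>(1) \<rho> by (intro complexification_divide complexification_prod)
  moreover have "(\<Prod>i\<in>{1..k}. \<epsilon> (m i)) > 0"
    using assms(2) by (intro prod_pos) (auto simp: pos_fundamental_unit_def)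
  ultimately have "\<exists>y\<in>K. (\<Prod>i\<in>{1..k}. \<epsilon> (m i)) = y\<^sup>2"
    by (rule_tac pos_square_in_complexification)
  then show ?thesis unfolding K_def M_def .
qed

end
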